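(* Consider the single decision maker setting described in the context. Fix a round $t$ and suppose: (H1) $\mathcal{E}_t=\boldsymbol{\mathcal{E}}$ for a fixed matrix $\boldsymbol{\mathcal{E}}\in\mathbb{R}^{m\times d}$ common to all agents; (H2) $\gamma_t=\gamma$ for a constant $\gamma\ge0$ common to all agents; (S1) there are $\boldsymbol{\alpha}\in\mathbb{R}^m$ and $\beta\in\mathbb{R}$ with $\mathrm{cBP}(\boldsymbol{\theta}_t)=\boldsymbol{\alpha}^\top\boldsymbol{\theta}_t+\beta$ for all admissible $\boldsymbol{\theta}_t$; (S2) the admissible parameters are those $\boldsymbol{\theta}_t\in\mathbb{R}^m$ with $\|\boldsymbol{\theta}_t\|_2\le 1$. Let $\boldsymbol{\theta}^{\mathrm{AO}}=\dfrac{\boldsymbol{\alpha}+\gamma\boldsymbol{\mathcal{E}}\boldsymbol{\mathcal{E}}^\top\boldsymbol{\theta}^*}{\|\boldsymbol{\alpha}+\gamma\boldsymbol{\mathcal{E}}\boldsymbol{\mathcal{E}}^\top\boldsymbol{\theta}^*\|_2}$ (assuming the denominator is nonzero), assume $\boldsymbol{\theta}^{\mathrm{AO}}\ne\boldsymbol{\theta}^*$, and suppose the decision maker considers only the two choices $\boldsymbol{\theta}_t\in\{\boldsymbol{\theta}^*,\boldsymbol{\theta}^{\mathrm{AO}}\}$. Suppose further: (1) $\|\boldsymbol{\theta}^*\|_2\le1$; (2) $\boldsymbol{\alpha}=(k-\gamma)\boldsymbol{\mathcal{E}}\boldsymbol{\mathcal{E}}^\top\boldsymbol{\theta}^*$ with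 $k,\gamma>0$; (3) $B_t\sim\mathcal{N}(0,\sigma^2I)$ with $I$ the identity matrix and $\sigma>0$; (4) the selection rule has the form $\boldsymbol{\delta}_{\boldsymbol{\theta}_t}(\mathbf{x})=\widetilde{\boldsymbol{\delta}}(\hat y_t(\boldsymbol{\theta}_t))$ with $\hat y_t(\boldsymbol{\theta}_t)=\mathbf{x}^\top\boldsymbol{\theta}_t$, where $\widetilde{\boldsymbol{\delta}}$ is increasing and Lipschitz: $|\widetilde{\boldsymbol{\delta}}(\hat y)-\widetilde{\boldsymbol{\delta}}(\hat y')|\le L|\hat y-\hat y'|$ for some $L>0$. Let $\xi(\boldsymbol{\theta}_t):=p(W_t=1\mid B_t;\boldsymbol{\theta}_t)$ be the admission chance of agent $t$ (a function of the random baseline $B_t$), and let $\Phi$ be the cumulative distribution function of $\mathcal{N}(0,1)$. Then $$\lambda:=\gamma\big((\boldsymbol{\theta}^{\mathrm{AO}})^\top\boldsymbol{\mathcal{E}}\boldsymbol{\mathcal{E}}^\top\boldsymbol{\theta}^{\mathrm{AO}}-(\boldsymbol{\theta}^* )^\top\boldsymbol{\mathcal{E}}\boldsymbol{\mathcal{E}}^\top\boldsymbol{\theta}^*\big)\ge0,$$ and for any $M>0$, $$p\big(\xi(\boldsymbol{\theta}^* )-\xi(\boldsymbol{\theta}^{\mathrm{AO}})>M\big)\le\Phi\!\left(\frac{-M/L-\lambda}{\sigma\|\boldsymbol{\theta}^{\mathrm{AO}}-\boldsymbol{\theta}^*\|_2}\right).$$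
   Context: Single decision maker (DM) setting. In round $t$ the DM publishes a parameter vector $\boldsymbol{\theta}_t\in\mathbb{R}^m$ and a selection rule $\boldsymbol{\delta}_{\boldsymbol{\theta}_t}:\mathbb{R}^m\to[0,1]$. An agent arrives with random baseline $B_t\in\mathbb{R}^m$, effort conversion matrix $\mathcal{E}_t\in\mathbb{R}^{m\times d}$ and real-valued noise $O_t$ (possibly correlated with $B_t$). If the agent takes action $\mathbf{a}\in\mathbb{R}^d$, its covariates are $X_t=B_t+\mathcal{E}_t\mathbf{a}$ and its predicted outcome is $\hat y_t=X_t^\top\boldsymbol{\theta}_t$. The agent chooses the action maximising $\gamma_t\hat y_t-\frac12\|\mathbf{a}\|_2^2$ (with $\gamma_t\ge0$), i.e. $\mathbf{a}_t=\gamma_t\mathcal{E}_t^\top\boldsymbol{\theta}_t$, so $X_t=B_t+\gamma_t\mathcal{E}_t\mathcal{E}_t^\top\boldsymbol{\theta}_t$. The selection status is $W_t\in\{0,1\}$ with $W_t\sim\mathrm{Bernoulli}(\boldsymbol{\delta}_{\boldsymbol{\theta}_t}(X_t))$ given $X_t$; selected agents comply. The outcome is $Y_t=X_t^\top\boldsymbol{\theta}^*+O_t$, where $\boldsymbol{\theta}^*\in\mathbb{R}^m$ is a fixed true causal parameter. The notation "$;\boldsymbol{\theta}_t$" indicates that the distribution is the one induced by deploying $\boldsymbol{\theta}_t$; the same baseline $B_t$ is used when comparing different deployed parameters. The conditional base performance is $\mathrm{cBP}(\boldsymbol{\theta}_t)=\mathbb{E}[B_t^\top\boldsymbol{\theta}^*+O_t\mid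 W_t=1;\boldsymbol{\theta}_t]$ (assumed well defined). *)

theory Defs
  imports "HOL-Probability.Probability"
begin

definition predicted_outcome :: "real^'m \<Rightarrow> real^'m \<Rightarrow> real" where
  "predicted_outcome x \<theta> = x \<bullet> \<theta>"

definition agent_payoff ::
    "real^'m \<Rightarrow> real^'d^'m \<Rightarrow> real \<Rightarrow> real^'m \<Rightarrow> real^'d \<Rightarrow> real" where
  "agent_payoff b A g \<theta> a = g * predicted_outcome (b + A *v a) \<theta> - (norm a)\<^sup>2 / 2"

definition agent_action ::
    "real^'m \<Rightarrow> real^'d^'m \<Rightarrow> real \<Rightarrow> real^'m \<Rightarrow> real^'d" where
  "agent_action b A g \<theta> = (ARG_MAX (agent_payoff b A g \<theta>) a. True)"

lemma agent_payoff_eq: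
  "agent_payoff b A g \<theta> a =
     g * (b \<bullet> \<theta>) + (norm (g *\<^sub>R (transpose A *v \<theta>)))\<^sup>2 / 2
       - (norm (a - g *\<^sub>R (transpose A *v \<theta>)))\<^sup>2 / 2"
proof -
  have 1: "(A *v a) \<bullet> \<theta> = a \<bullet> (transpose A *v \<theta>)"
    by (metis dot_lmul_matrix inner_commute transpose_matrix_vector)
  have 2: "(norm (a - u))\<^sup>2 = (norm a)\<^sup>2 - 2 * (a \<bullet> u) + (norm u)\<^sup>2" for u
    by (simp add: power2_norm_eq_inner inner_diff_left inner_diff_right inner_commute)
  show ?thesis
    unfolding agent_payoff_def predicted_outcome_def 2
    by (simp add: inner_add_left 1 field_simps)
qed

lemma agent_action_eq: "agent_action b A g \<theta> = g *\<^sub>R (transpose A *v \<theta>)"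
proof -
  have "is_arg_max (agent_payoff b A g \<theta>) (\<lambda>_. True) a \<longleftrightarrow> a = g *\<^sub>R (transpose A *v \<theta>)" for a
  proof
    assume "is_arg_max (agent_payoff b A g \<theta>) (\<lambda>_. True) a"
    then have "\<not> agent_payoff b A g \<theta> (g *\<^sub>R (transpose A *v \<theta>)) > agent_payoff b A g \<theta> a"
      by (auto simp: is_arg_max_def)
    then show "a = g *\<^sub>R (transpose A *v \<theta>)"
      by (simp add: agent_payoff_eq)
  next
    assume "a = g *\<^sub>R (transpose A *v \<theta>)"
    then show "is_arg_max (agent_payoff b A g \<theta>) (\<lambda>_. True) a"
      by (simp add: is_arg_max_def agent_payoff_eq not_less)
  qed
  then show ?thesis
    unfolding agent_action_def arg_max_def by (intro some_equality) blast+
qed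

definition covariates ::
    "('w \<Rightarrow> real^'m) \<Rightarrow> ('w \<Rightarrow> real^'d^'m) \<Rightarrow> ('w \<Rightarrow> real) \<Rightarrow> real^'m \<Rightarrow> 'w \<Rightarrow> real^'m" where
  "covariates B Ef g \<theta> \<omega> = B \<omega> + Ef \<omega> *v agent_action (B \<omega>) (Ef \<omega>) (g \<omega>) \<theta>"

lemma covariates_eq:
  "covariates B Ef g \<theta> \<omega> = B \<omega> + g \<omega> *\<^sub>R ((Ef \<omega> ** transpose (Ef \<omega>)) *v \<theta>)"
  by (simp add: covariates_def agent_action_eq matrix_vector_mult_scaleR
      matrix_vector_mul_assoc del: transpose_matrix_vector)

text \<open>A version of the conditional probability of \<open>P\<close> given the sigma-algebra generated by \<open>Z\<close>.\<close>

definition cond_prob_given ::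
    "'w measure \<Rightarrow> ('w \<Rightarrow> 'b::topological_space) \<Rightarrow> ('w \<Rightarrow> bool) \<Rightarrow> 'w \<Rightarrow> real" where
  "cond_prob_given M Z P =
     real_cond_exp M (vimage_algebra (space M) Z borel) (indicator {\<omega> \<in> space M. P \<omega>})"

text \<open>
  One round of the interaction with a single decision maker. All deployments are realised on one
  probability space, so that the agent (\<open>B\<close>, \<open>Ef\<close>, \<open>g\<close>, \<open>N\<close>) is the same for every \<open>\<theta>\<close>, whereas the
  selection status \<open>W \<theta>\<close> and the outcome \<open>Y \<theta>\<close> depend on the deployed \<open>\<theta> \<in> \<Theta>\<close>; nothing is assumed
  about the joint law of \<open>W \<theta>\<close> and \<open>W \<theta>'\<close>. \<open>Ef\<close>, \<open>g\<close> and \<open>N\<close> are the effort conversion matrix,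
  \<open>\<gamma>\<close> and the outcome noise, and the selection status \<open>1\<close> is \<open>True\<close>.
\<close>

locale single_dm_round = prob_space M
  for M :: "'w measure"
    and B :: "'w \<Rightarrow> real^'m"
    and Ef :: "'w \<Rightarrow> real^'d^'m"
    and g :: "'w \<Rightarrow> real"
    and N :: "'w \<Rightarrow> real"
    and \<theta>s :: "real^'m"
    and \<Theta> :: "(real^'m) set"
    and \<delta> :: "real^'m \<Rightarrow> real^'m \<Rightarrow> real"
    and W :: "real^'m \<Rightarrow> 'w \<Rightarrow> bool"
    and Y :: "real^'m \<Rightarrow> 'w \<Rightarrow> real" +
  assumes baseline_measurable: "B \<in> borel_measurable M"
    and effort_measurable: "Ef \<in> borel_measurable M"
    and gamma_measurable: "g \<in> borel_measurable M"
    and noise_measurable: "N \<in> borel_measurable M"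
    and gamma_nonneg: "\<And>\<omega>. \<omega> \<in> space M \<Longrightarrow> 0 \<le> g \<omega>"
    and rule_measurable: "\<And>\<theta>. \<theta> \<in> \<Theta> \<Longrightarrow> \<delta> \<theta> \<in> borel_measurable borel"
    and rule_range: "\<And>\<theta> x. \<theta> \<in> \<Theta> \<Longrightarrow> \<delta> \<theta> x \<in> {0..1}"
    and selection_measurable: "\<And>\<theta>. \<theta> \<in> \<Theta> \<Longrightarrow> W \<theta> \<in> measurable M (count_space UNIV)"
    and selection_bernoulli: "\<And>\<theta>. \<theta> \<in> \<Theta> \<Longrightarrow>
      AE \<omega> in M. cond_prob_given M (covariates B Ef g \<theta>) (W \<theta>) \<omega> = \<delta> \<theta> (covariates B Ef g \<theta> \<omega>)"
    and outcome: "\<And>\<theta> \<omega>. \<theta> \<in> \<Theta> \<Longrightarrow> \<omega> \<in> space M \<Longrightarrow>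
      Y \<theta> \<omega> = covariates B Ef g \<theta> \<omega> \<bullet> \<theta>s + N \<omega>"

definition selected_measure ::
    "'w measure \<Rightarrow> (real^'m \<Rightarrow> 'w \<Rightarrow> bool) \<Rightarrow> real^'m \<Rightarrow> 'w measure" where
  "selected_measure M W \<theta> = uniform_measure M {\<omega> \<in> space M. W \<theta> \<omega>}"

definition cBP ::
    "'w measure \<Rightarrow> ('w \<Rightarrow> real^'m) \<Rightarrow> ('w \<Rightarrow> real) \<Rightarrow> real^'m \<Rightarrow> (real^'m \<Rightarrow> 'w \<Rightarrow> bool)
      \<Rightarrow> real^'m \<Rightarrow> real" where
  "cBP M B N \<theta>s W \<theta> = (LINT \<omega>|selected_measure M W \<theta>. B \<omega> \<bullet> \<theta>s + N \<omega>)"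

text \<open>Needed because \<open>LINT\<close> silently returns \<open>0\<close> for non-integrable functions, and
  \<open>uniform_measure\<close> is not a probability measure when conditioning on a null event.\<close>

definition cBP_well_defined ::
    "'w measure \<Rightarrow> ('w \<Rightarrow> real^'m) \<Rightarrow> ('w \<Rightarrow> real) \<Rightarrow> real^'m \<Rightarrow> (real^'m \<Rightarrow> 'w \<Rightarrow> bool)
      \<Rightarrow> real^'m \<Rightarrow> bool" where
  "cBP_well_defined M B N \<theta>s W \<theta> \<longleftrightarrow>
     measure M {\<omega> \<in> space M. W \<theta> \<omega>} > 0 \<and>
     integrable (selected_measure M W \<theta>) (\<lambda>\<omega>. B \<omega> \<bullet> \<theta>s + N \<omega>)"

definition admission_chance ::
    "'w measure \<Rightarrow> ('w \<Rightarrow> real^'m) \<Rightarrow> (real^'m \<Rightarrow> 'w \<Rightarrow> bool) \<Rightarrow> real^'m \<Rightarrow> 'w \<Rightarrow> real" where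
  "admission_chance M B W \<theta> = cond_prob_given M B (W \<theta>)"

text \<open>Density of the multivariate normal distribution; meaningful for symmetric positive definite
  covariance matrices \<open>S\<close> only.\<close>

definition mv_normal_density :: "real^'m \<Rightarrow> real^'m^'m \<Rightarrow> real^'m \<Rightarrow> real" where
  "mv_normal_density \<mu> S x =
     exp (- ((x - \<mu>) \<bullet> (matrix_inv S *v (x - \<mu>))) / 2) / sqrt ((2 * pi) ^ CARD('m) * det S)"

end

theory Submission
  imports Defs
begin

text \<open>
  Under the alignment condition \<open>\<theta>AO\<close> is the normalised image of \<open>\<theta>s\<close> under the Gram matrix
  \<open>E E\<^sup>T\<close>, and \<open>lam \<ge> 0\<close> follows from two applications of the Cauchy-Schwarz inequality. The
  covariates are a translate of \<open>B\<close>, hence generate the same sigma-algebra, so the admission chance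
  is almost surely the selection rule evaluated at the translate. By monotonicity and the Lipschitz
  bound, a gap above \<open>m\<close> forces \<open>B \<bullet> (\<theta>AO - \<theta>s) < - m / L - lam\<close>, which is a tail event of a
  centred normal variable with standard deviation \<open>\<sigma> * norm (\<theta>AO - \<theta>s)\<close>.
\<close>

section \<open>Vectors with a product density: marginals and independence of the coordinates\<close>

text \<open>The indicator of a box factors over the coordinates just as the density does, so Tonelli
  splits the integral. Both the marginals and the joint law below are read off from this
  formula.\<close>

lemma emeasure_box_product_density:
  fixes X :: "'w \<Rightarrow> 'a::euclidean_space" and f :: "'a \<Rightarrow> real \<Rightarrow> real"
  assumes X: "distributed M lborel X (\<lambda>x. ennreal (\<Prod>b\<in>Basis. f b (x \<bullet> b)))"
    and f [measurable]: "\<And>b. b \<in> Basis \<Longrightarrow> f b \<in> borel_measurable borel"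
    and nonneg: "\<And>b x. b \<in> Basis \<Longrightarrow> 0 \<le> f b x"
    and A [measurable]: "\<And>b. b \<in> Basis \<Longrightarrow> A b \<in> sets borel"
  shows "emeasure M {\<omega> \<in> space M. \<forall>b\<in>Basis. X \<omega> \<bullet> b \<in> A b} =
    (\<Prod>b\<in>Basis. \<integral>\<^sup>+x. ennreal (f b x) * indicator (A b) x \<partial>lborel)"
proof -
  have "{x. \<forall>b\<in>Basis. x \<bullet> b \<in> A b} \<in> sets (borel :: 'a measure)"
    by measurable
  then have "emeasure M (X -` {x. \<forall>b\<in>Basis. x \<bullet> b \<in> A b} \<inter> space M) =
    (\<integral>\<^sup>+x. ennreal (\<Prod>b\<in>Basis. f b (x \<bullet> b)) * indicator {x. \<forall>b\<in>Basis. x \<bullet> b \<in> A b} x \<partial>lborel)"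
    by (intro distributed_emeasure[OF X]) auto
  also have "\<dots> = (\<integral>\<^sup>+x. (\<Prod>b\<in>Basis. ennreal (f b (x \<bullet> b)) * indicator (A b) (x \<bullet> b)) \<partial>lborel)"
  proof (intro nn_integral_cong)
    fix x :: 'a
    have "indicator {x. \<forall>b\<in>Basis. x \<bullet> b \<in> A b} x = (\<Prod>b\<in>Basis. indicator (A b) (x \<bullet> b) :: ennreal)"
      by (auto simp: indicator_def prod_zero_iff)
    then show "ennreal (\<Prod>b\<in>Basis. f b (x \<bullet> b)) * indicator {x. \<forall>b\<in>Basis. x \<bullet> b \<in> A b} x =
      (\<Prod>b\<in>Basis. ennreal (f b (x \<bullet> b)) * indicator (A b) (x \<bullet> b))"
      by (simp add: prod.distrib prod_ennreal nonneg)
  qed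
  also have "\<dots> = (\<Prod>b\<in>Basis. \<integral>\<^sup>+x. ennreal (f b x) * indicator (A b) x \<partial>lborel)"
    by (rule nn_integral_lborel_prod) auto
  finally show ?thesis
    by (simp add: vimage_def Int_def conj_commute)
qed

text \<open>A condition on one coordinate is a box whose other sides are \<open>UNIV\<close>; by
  \<open>total\<close> those sides contribute the factor 1.\<close>

lemma distributed_component_product_density:
  fixes X :: "'w \<Rightarrow> 'a::euclidean_space" and f :: "'a \<Rightarrow> real \<Rightarrow> real"
  assumes X: "distributed M lborel X (\<lambda>x. ennreal (\<Prod>b\<in>Basis. f b (x \<bullet> b)))"
    and f [measurable]: "\<And>b. b \<in> Basis \<Longrightarrow> f b \<in> borel_measurable borel"
    and nonneg: "\<And>b x. b \<in> Basis \<Longrightarrow> 0 \<le> f b x"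
    and total: "\<And>b. b \<in> Basis \<Longrightarrow> (\<integral>\<^sup>+x. ennreal (f b x) \<partial>lborel) = 1"
    and c: "c \<in> Basis"
  shows "distributed M lborel (\<lambda>\<omega>. X \<omega> \<bullet> c) (f c)"
proof -
  have [measurable]: "X \<in> borel_measurable M"
    using distributed_measurable[OF X] by simp
  note f[OF c, measurable]
  have "distr M lborel (\<lambda>\<omega>. X \<omega> \<bullet> c) = density lborel (\<lambda>x. ennreal (f c x))"
  proof (rule measure_eqI)
    fix A assume "A \<in> sets (distr M lborel (\<lambda>\<omega>. X \<omega> \<bullet> c))"
    then have A [measurable]: "A \<in> sets borel"
      by simp
    have "emeasure (distr M lborel (\<lambda>\<omega>. X \<omega> \<bullet> c)) A = emeasure M {\<omega> \<in> space M. X \<omega> \<bullet> c \<in> A}"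
      by (simp add: emeasure_distr vimage_def Int_def conj_commute)
    also have "{\<omega> \<in> space M. X \<omega> \<bullet> c \<in> A} =
        {\<omega> \<in> space M. \<forall>b\<in>Basis. X \<omega> \<bullet> b \<in> (if b = c then A else UNIV)}"
      using c by auto
    also have "emeasure M \<dots> =
        (\<Prod>b\<in>Basis. \<integral>\<^sup>+x. ennreal (f b x) * indicator (if b = c then A else UNIV) x \<partial>lborel)"
      by (rule emeasure_box_product_density[OF X f nonneg]) auto
    also have "\<dots> = (\<Prod>b\<in>Basis. if b = c then \<integral>\<^sup>+x. ennreal (f c x) * indicator A x \<partial>lborel else 1)"
      by (intro prod.cong) (auto simp: total)
    also have "\<dots> = emeasure (density lborel (\<lambda>x. ennreal (f c x))) A"
      using c by (simp add: emeasure_density)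
    finally show "emeasure (distr M lborel (\<lambda>\<omega>. X \<omega> \<bullet> c)) A =
        emeasure (density lborel (\<lambda>x. ennreal (f c x))) A" .
  qed simp
  then show ?thesis
    by (simp add: distributed_def)
qed

text \<open>A finite product measure is determined by its values on rectangles. There the box
  formula yields the product of the marginals, so the joint law of the coordinates is the product
  law, which is independence.\<close>

lemma (in prob_space) indep_components_product_density:
  fixes X :: "'a \<Rightarrow> 'b::euclidean_space" and f :: "'b \<Rightarrow> real \<Rightarrow> real"
  assumes X: "distributed M lborel X (\<lambda>x. ennreal (\<Prod>b\<in>Basis. f b (x \<bullet> b)))"
    and f [measurable]: "\<And>b. b \<in> Basis \<Longrightarrow> f b \<in> borel_measurable borel"
    and nonneg: "\<And>b x. b \<in> Basis \<Longrightarrow> 0 \<le> f b x"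
    and total: "\<And>b. b \<in> Basis \<Longrightarrow> (\<integral>\<^sup>+x. ennreal (f b x) \<partial>lborel) = 1"
  shows "indep_vars (\<lambda>_. borel) (\<lambda>b \<omega>. X \<omega> \<bullet> b) Basis"
proof -
  have [measurable]: "X \<in> borel_measurable M"
    using distributed_measurable[OF X] by simp
  \<comment> \<open>The locale asks for a probability measure at every index, not only at basis
    vectors; \<open>X \<omega> \<bullet> b\<close> is measurable for every \<open>b\<close>, so the
    pushforward always qualifies.\<close>
  interpret P: product_prob_space "\<lambda>b. distr M borel (\<lambda>\<omega>. X \<omega> \<bullet> b)"
    by (intro product_prob_spaceI prob_space_distr) simp
  have "distr M (\<Pi>\<^sub>M b\<in>Basis. borel) (\<lambda>\<omega>. \<lambda>b\<in>Basis. X \<omega> \<bullet> b) =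
      (\<Pi>\<^sub>M b\<in>Basis. distr M borel (\<lambda>\<omega>. X \<omega> \<bullet> b))"
  proof (rule P.PiM_eqI)
    fix A :: "'b \<Rightarrow> real set"
    assume "\<And>b. b \<in> Basis \<Longrightarrow> A b \<in> sets (distr M borel (\<lambda>\<omega>. X \<omega> \<bullet> b))"
    then have A [measurable]: "\<And>b. b \<in> Basis \<Longrightarrow> A b \<in> sets borel"
      by simp
    have "emeasure (distr M (\<Pi>\<^sub>M b\<in>Basis. borel) (\<lambda>\<omega>. \<lambda>b\<in>Basis. X \<omega> \<bullet> b)) (Pi\<^sub>E Basis A) =
        emeasure M {\<omega> \<in> space M. \<forall>b\<in>Basis. X \<omega> \<bullet> b \<in> A b}"
      by (subst emeasure_distr)
        (auto intro!: sets_PiM_I_finite measurable_restrict arg_cong[where f="emeasure M"])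
    also have "\<dots> = (\<Prod>b\<in>Basis. \<integral>\<^sup>+x. ennreal (f b x) * indicator (A b) x \<partial>lborel)"
      by (rule emeasure_box_product_density[OF X f nonneg A])
    also have "\<dots> = (\<Prod>b\<in>Basis. emeasure (distr M borel (\<lambda>\<omega>. X \<omega> \<bullet> b)) (A b))"
    proof (rule prod.cong[OF refl])
      fix b :: 'b assume b: "b \<in> Basis"
      show "(\<integral>\<^sup>+x. ennreal (f b x) * indicator (A b) x \<partial>lborel) =
          emeasure (distr M borel (\<lambda>\<omega>. X \<omega> \<bullet> b)) (A b)"
        using distributed_emeasure[OF distributed_component_product_density[OF X f nonneg total b], of "A b"]
          A[OF b]
        by (simp add: emeasure_distr)
    qed
    finally show "emeasure (distr M (\<Pi>\<^sub>M b\<in>Basis. borel) (\<lambda>\<omega>. \<lambda>b\<in>Basis. X \<omega> \<bullet> b)) (Pi\<^sub>E Basis A) =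
        (\<Prod>b\<in>Basis. emeasure (distr M borel (\<lambda>\<omega>. X \<omega> \<bullet> b)) (A b))" .
  qed (simp_all cong: sets_PiM_cong)
  then show ?thesis
    by (subst indep_vars_iff_distr_eq_PiM') auto
qed

section \<open>Linear functionals of an isotropic Gaussian vector\<close>

lemma (in prob_space) isotropic_normal_inner:
  fixes X :: "'a \<Rightarrow> 'b::euclidean_space"
  assumes X: "distributed M lborel X (\<lambda>x. ennreal (\<Prod>b\<in>Basis. normal_density 0 \<sigma> (x \<bullet> b)))"
    and \<sigma>: "\<sigma> > 0" and v: "v \<noteq> 0"
  shows "distributed M lborel (\<lambda>\<omega>. X \<omega> \<bullet> v) (normal_density 0 (\<sigma> * norm v))"
proof -
  \<comment> \<open>A zero coefficient would give a degenerate summand with standard deviation 0,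
    which \<open>sum_indep_normal\<close> excludes. \<open>J\<close> drops these coordinates and
    stays nonempty because \<open>v \<noteq> 0\<close>; since the dropped terms vanish, the sum and
    the variance can be extended to all of \<open>Basis\<close> afterwards.\<close>
  define J where "J = {b \<in> Basis. v \<bullet> b \<noteq> 0}"
  have J: "finite J" "J \<noteq> {}" "J \<subseteq> Basis"
    using v euclidean_all_zero_iff[of v] by (auto simp: J_def)
  have total: "(\<integral>\<^sup>+x. ennreal (normal_density 0 \<sigma> x) \<partial>lborel) = 1"
    using prob_space.emeasure_space_1[OF prob_space_normal_density[OF \<sigma>, of 0]]
    by (simp add: emeasure_density)
  have "indep_vars (\<lambda>_. borel) (\<lambda>b \<omega>. X \<omega> \<bullet> b) J"
    using J(3) by (intro indep_vars_subset[OF indep_components_product_density[OF X]]) (auto simp: total)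
  then have "indep_vars (\<lambda>_. borel) (\<lambda>b \<omega>. (v \<bullet> b) * (X \<omega> \<bullet> b)) J"
    by (rule indep_vars_compose2) simp
  moreover have "distributed M lborel (\<lambda>\<omega>. (v \<bullet> b) * (X \<omega> \<bullet> b)) (normal_density 0 (\<bar>v \<bullet> b\<bar> * \<sigma>))"
    if "b \<in> J" for b
    using normal_density_affine[OF distributed_component_product_density[OF X] \<sigma>, of b "v \<bullet> b" 0] that
    by (simp add: J_def total)
  ultimately have "distributed M lborel (\<lambda>\<omega>. \<Sum>b\<in>J. (v \<bullet> b) * (X \<omega> \<bullet> b))
      (normal_density (\<Sum>b\<in>J. 0) (sqrt (\<Sum>b\<in>J. (\<bar>v \<bullet> b\<bar> * \<sigma>)\<^sup>2)))"
    using J \<sigma> by (intro sum_indep_normal) (auto simp: J_def)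
  moreover have "(\<Sum>b\<in>J. (v \<bullet> b) * (X \<omega> \<bullet> b)) = X \<omega> \<bullet> v" for \<omega>
  proof -
    have "(\<Sum>b\<in>J. (v \<bullet> b) * (X \<omega> \<bullet> b)) = (\<Sum>b\<in>Basis. (v \<bullet> b) * (X \<omega> \<bullet> b))"
      by (rule sum.mono_neutral_left) (auto simp: J_def)
    then show ?thesis
      by (simp add: euclidean_inner[of "X \<omega>" v] mult.commute)
  qed
  moreover have "sqrt (\<Sum>b\<in>J. (\<bar>v \<bullet> b\<bar> * \<sigma>)\<^sup>2) = \<sigma> * norm v"
  proof -
    have "(\<Sum>b\<in>J. (\<bar>v \<bullet> b\<bar> * \<sigma>)\<^sup>2) = (\<Sum>b\<in>Basis. (\<bar>v \<bullet> b\<bar> * \<sigma>)\<^sup>2)"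
      by (rule sum.mono_neutral_left) (auto simp: J_def)
    also have "\<dots> = (\<sigma> * norm v)\<^sup>2"
      by (simp add: norm_eq_sqrt_inner euclidean_inner[of v v] power_mult_distrib power2_eq_square
          sum_distrib_left sum_distrib_right sum_nonneg mult_ac)
    finally show ?thesis
      using \<sigma> by simp
  qed
  ultimately show ?thesis
    by simp
qed

lemma matrix_inv_unique:
  fixes A C :: "real^'n^'n"
  assumes "A ** C = mat 1" "C ** A = mat 1"
  shows "matrix_inv A = C"
proof -
  have "A ** matrix_inv A = mat 1"
    unfolding matrix_inv_def using assms by (rule_tac someI2[of _ C]) auto
  then have "C ** (A ** matrix_inv A) = C"
    by simp
  then show ?thesis
    by (simp add: matrix_mul_assoc assms)
qed

text \<open>Brings the matrix form of the density into the product form required above: for a scalar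
  covariance the inverse is scalar, the determinant is a power of \<open>\<sigma>\<^sup>2\<close>,
  and the exponential of the squared norm splits over the coordinates.\<close>

lemma mv_normal_density_isotropic:
  fixes x :: "real^'m"
  assumes \<sigma>: "\<sigma> > 0"
  shows "mv_normal_density 0 (\<sigma>\<^sup>2 *\<^sub>R mat 1) x = (\<Prod>b\<in>Basis. normal_density 0 \<sigma> (x \<bullet> b))"
proof -
  have inv: "matrix_inv (\<sigma>\<^sup>2 *\<^sub>R (mat 1 :: real^'m^'m)) = (1 / \<sigma>\<^sup>2) *\<^sub>R mat 1"
  proof (rule matrix_inv_unique)
    show "(\<sigma>\<^sup>2 *\<^sub>R mat 1 :: real^'m^'m) ** ((1 / \<sigma>\<^sup>2) *\<^sub>R mat 1) = mat 1"
      "((1 / \<sigma>\<^sup>2) *\<^sub>R mat 1 :: real^'m^'m) ** (\<sigma>\<^sup>2 *\<^sub>R mat 1) = mat 1"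
    using \<sigma> by (simp_all add: scalar_matrix_assoc matrix_scalar_ac)
  qed
  have det: "det (\<sigma>\<^sup>2 *\<^sub>R (mat 1 :: real^'m^'m)) = (\<sigma>\<^sup>2) ^ CARD('m)"
    by (subst det_diagonal) (auto simp: mat_def)
  have card: "card (Basis :: (real^'m) set) = CARD('m)"
    by simp
  have "(\<Prod>b\<in>Basis. normal_density 0 \<sigma> (x \<bullet> b)) =
      (1 / sqrt (2 * pi * \<sigma>\<^sup>2)) ^ CARD('m) * exp (\<Sum>b\<in>Basis. - (x \<bullet> b)\<^sup>2 / (2 * \<sigma>\<^sup>2))"
    unfolding normal_density_def prod.distrib prod_constant card
    by (simp add: exp_sum)
  also have "(\<Sum>b\<in>Basis. - (x \<bullet> b)\<^sup>2 / (2 * \<sigma>\<^sup>2)) = - (x \<bullet> x) / (2 * \<sigma>\<^sup>2)"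
    by (simp add: euclidean_inner[of x x] power2_eq_square sum_negf sum_divide_distrib)
  finally show ?thesis
    unfolding mv_normal_density_def inv det
    by (simp add: real_sqrt_power power_mult_distrib real_sqrt_mult field_simps scaleR_matrix_vector_assoc[symmetric])
qed

section \<open>The Gram quadratic form at a normalised image\<close>

text \<open>With \<open>p\<close> and \<open>q\<close> the images of \<open>\<theta>\<close> and
  \<open>u\<close> under \<open>transpose E\<close>, the claim is that the norm of \<open>p\<close>
  is at most that of \<open>q\<close>. The choice of \<open>u\<close> makes
  \<open>q \<bullet> p\<close> the norm of the Gram image of \<open>\<theta>\<close>. Cauchy-Schwarz
  and \<open>norm \<theta> \<le> 1\<close> bound the squared norm of \<open>p\<close> by
  \<open>q \<bullet> p\<close>, a second Cauchy-Schwarz bounds that by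
  \<open>norm q * norm p\<close>, and one factor cancels.\<close>

lemma gram_form_le_normalized_image:
  fixes E :: "real^'d^'m" and \<theta> :: "real^'m"
  assumes nz: "(E ** transpose E) *v \<theta> \<noteq> 0" and \<theta>: "norm \<theta> \<le> 1"
    and u: "u = ((E ** transpose E) *v \<theta>) /\<^sub>R norm ((E ** transpose E) *v \<theta>)"
  shows "\<theta> \<bullet> ((E ** transpose E) *v \<theta>) \<le> u \<bullet> ((E ** transpose E) *v u)"
proof -
  define p where "p = transpose E *v \<theta>"
  define q where "q = transpose E *v u"
  have gram: "x \<bullet> ((E ** transpose E) *v y) = (transpose E *v x) \<bullet> (transpose E *v y)" for x y
    by (simp add: dot_lmul_matrix flip: matrix_vector_mul_assoc)
  have "u \<bullet> ((E ** transpose E) *v \<theta>) = norm ((E ** transpose E) *v \<theta>)"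
    using nz by (simp add: u power2_norm_eq_inner[symmetric] power2_eq_square)
  then have qp: "q \<bullet> p = norm ((E ** transpose E) *v \<theta>)"
    by (simp add: gram p_def q_def)
  have "norm p * norm p = \<theta> \<bullet> ((E ** transpose E) *v \<theta>)"
    by (simp add: gram p_def power2_norm_eq_inner[symmetric] power2_eq_square)
  also have "\<dots> \<le> norm \<theta> * norm ((E ** transpose E) *v \<theta>)"
    by (rule norm_cauchy_schwarz)
  also have "\<dots> \<le> q \<bullet> p"
    using \<theta> by (simp add: qp mult_left_le_one_le)
  also have "\<dots> \<le> norm q * norm p"
    by (rule norm_cauchy_schwarz)
  finally have "norm p * norm p \<le> norm q * norm p" .
  \<comment> \<open>If \<open>p\<close> were 0, then \<open>qp\<close> would make the Gram image of
    \<open>\<theta>\<close> vanish, against \<open>nz\<close>.\<close>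
  moreover have "p \<noteq> 0"
    using nz qp by auto
  ultimately have "norm p \<le> norm q"
    by simp
  then have "(norm p)\<^sup>2 \<le> (norm q)\<^sup>2"
    by simp
  then show ?thesis
    by (simp add: gram p_def q_def power2_norm_eq_inner)
qed

section \<open>Conditioning on the covariates and on the baseline\<close>

text \<open>Translation is a homeomorphism, so the shift can be moved from the map onto the Borel
  set being pulled back.\<close>

lemma vimage_algebra_translate:
  fixes Z :: "'w \<Rightarrow> 'b::real_normed_vector"
  shows "vimage_algebra X (\<lambda>\<omega>. Z \<omega> + c) borel = vimage_algebra X Z borel"
proof -
  have "{(\<lambda>\<omega>. Z \<omega> + c) -` A \<inter> X |A. A \<in> sets borel} = {Z -` A \<inter> X |A. A \<in> sets borel}"
  proof (intro equalityI subsetI)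
    fix S assume "S \<in> {(\<lambda>\<omega>. Z \<omega> + c) -` A \<inter> X |A. A \<in> sets borel}"
    then obtain A where A: "A \<in> sets borel" "S = (\<lambda>\<omega>. Z \<omega> + c) -` A \<inter> X" by auto
    have "(\<lambda>x. x + c) -` A \<in> sets borel"
      using A(1) by (intro measurable_sets_borel[OF borel_measurable_continuous_onI]) (intro continuous_intros)
    moreover have "S = Z -` ((\<lambda>x. x + c) -` A) \<inter> X"
      using A(2) by auto
    ultimately show "S \<in> {Z -` A \<inter> X |A. A \<in> sets borel}" by blast
  next
    fix S assume "S \<in> {Z -` A \<inter> X |A. A \<in> sets borel}"
    then obtain A where A: "A \<in> sets borel" "S = Z -` A \<inter> X" by auto
    have "(\<lambda>x. x - c) -` A \<in> sets borel"
      using A(1) by (intro measurable_sets_borel[OF borel_measurable_continuous_onI]) (intro continuous_intros)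
    moreover have "S = (\<lambda>\<omega>. Z \<omega> + c) -` ((\<lambda>x. x - c) -` A) \<inter> X"
      using A(2) by auto
    ultimately show "S \<in> {(\<lambda>\<omega>. Z \<omega> + c) -` A \<inter> X |A. A \<in> sets borel}" by blast
  qed
  then show ?thesis
    by (simp add: vimage_algebra_def)
qed

lemma (in single_dm_round) admission_chance_eq:
  assumes Ef: "\<And>\<omega>. \<omega> \<in> space M \<Longrightarrow> Ef \<omega> = E"
    and g: "\<And>\<omega>. \<omega> \<in> space M \<Longrightarrow> g \<omega> = \<gamma>"
    and \<theta>: "\<theta> \<in> \<Theta>"
  shows "AE \<omega> in M. admission_chance M B W \<theta> \<omega> = \<delta> \<theta> (B \<omega> + \<gamma> *\<^sub>R ((E ** transpose E) *v \<theta>))"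
proof -
  have cov: "covariates B Ef g \<theta> \<omega> = B \<omega> + \<gamma> *\<^sub>R ((E ** transpose E) *v \<theta>)" if "\<omega> \<in> space M" for \<omega>
    by (simp add: covariates_eq Ef g that)
  have "vimage_algebra (space M) (covariates B Ef g \<theta>) borel =
      vimage_algebra (space M) (\<lambda>\<omega>. B \<omega> + \<gamma> *\<^sub>R ((E ** transpose E) *v \<theta>)) borel"
    by (rule vimage_algebra_cong) (auto simp: cov)
  \<comment> \<open>An equality of functions, not merely almost everywhere:
    \<open>cond_prob_given\<close> depends on the conditioning variable only through its
    sigma-algebra.\<close>
  then have "admission_chance M B W \<theta> = cond_prob_given M (covariates B Ef g \<theta>) (W \<theta>)"
    by (simp add: admission_chance_def cond_prob_given_def vimage_algebra_translate)
  moreover have "AE \<omega> in M. cond_prob_given M (covariates B Ef g \<theta>) (W \<theta>) \<omega> =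
      \<delta> \<theta> (B \<omega> + \<gamma> *\<^sub>R ((E ** transpose E) *v \<theta>))"
    using selection_bernoulli[OF \<theta>] by (rule AE_mp) (auto intro!: AE_I2 simp: cov)
  ultimately show ?thesis
    by simp
qed

section \<open>The Gaussian tail and the bound on the admission gap\<close>

lemma (in prob_space) normal_lower_tail:
  assumes X: "distributed M lborel X (normal_density 0 s)" and s: "s > 0"
  shows "prob {\<omega> \<in> space M. X \<omega> \<le> c} = cdf std_normal_distribution (c / s)"
proof -
  have Z: "distributed M lborel (\<lambda>\<omega>. X \<omega> / s) std_normal_density"
    using X normal_standard_normal_convert[OF s, of X 0] by simp
  have "cdf std_normal_distribution (c / s) = measure (distr M lborel (\<lambda>\<omega>. X \<omega> / s)) {..c / s}"
    by (simp add: cdf_def distributed_distr_eq_density[OF Z])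
  also have "\<dots> = prob ((\<lambda>\<omega>. X \<omega> / s) -` {..c / s} \<inter> space M)"
    using distributed_measurable[OF Z] by (simp add: measure_distr)
  also have "(\<lambda>\<omega>. X \<omega> / s) -` {..c / s} \<inter> space M = {\<omega> \<in> space M. X \<omega> \<le> c}"
    using s by (auto simp: divide_le_cancel)
  finally show ?thesis by simp
qed

theorem corollary3p3:
  fixes M :: "'w measure"
    and B :: "'w \<Rightarrow> real^'m"
    and Ef :: "'w \<Rightarrow> real^'d^'m"
    and g :: "'w \<Rightarrow> real"
    and N :: "'w \<Rightarrow> real"
    and \<theta>s \<theta>AO \<alpha> :: "real^'m"
    and \<Theta> :: "(real^'m) set"
    and \<delta> :: "real^'m \<Rightarrow> real^'m \<Rightarrow> real"
    and W :: "real^'m \<Rightarrow> 'w \<Rightarrow> bool"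
    and Y :: "real^'m \<Rightarrow> 'w \<Rightarrow> real"
    and E :: "real^'d^'m"
    and \<gamma> \<beta> k \<sigma> L lam :: real
    and \<delta>' :: "real \<Rightarrow> real"
  assumes model: "single_dm_round M B Ef g N \<theta>s \<Theta> \<delta> W Y"
    and cBP_defined: "\<And>\<theta>. \<theta> \<in> \<Theta> \<Longrightarrow> cBP_well_defined M B N \<theta>s W \<theta>"
    and H1: "\<And>\<omega>. \<omega> \<in> space M \<Longrightarrow> Ef \<omega> = E"
    and H2: "\<And>\<omega>. \<omega> \<in> space M \<Longrightarrow> g \<omega> = \<gamma>" "\<gamma> \<ge> 0"
    and S1: "\<And>\<theta>. \<theta> \<in> \<Theta> \<Longrightarrow> cBP M B N \<theta>s W \<theta> = \<alpha> \<bullet> \<theta> + \<beta>"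
    and S2: "\<Theta> = {\<theta>. norm \<theta> \<le> 1}"
    and AO_nonzero: "norm (\<alpha> + \<gamma> *\<^sub>R ((E ** transpose E) *v \<theta>s)) \<noteq> 0"
    and AO: "\<theta>AO = (\<alpha> + \<gamma> *\<^sub>R ((E ** transpose E) *v \<theta>s))
                /\<^sub>R norm (\<alpha> + \<gamma> *\<^sub>R ((E ** transpose E) *v \<theta>s))"
    and AO_neq: "\<theta>AO \<noteq> \<theta>s"
    and c1: "norm \<theta>s \<le> 1"
    and c2: "\<alpha> = (k - \<gamma>) *\<^sub>R ((E ** transpose E) *v \<theta>s)" "k > 0" "\<gamma> > 0"
    and c3: "distributed M lborel B (mv_normal_density 0 (\<sigma>\<^sup>2 *\<^sub>R mat 1))" "\<sigma> > 0"
    and c4: "\<And>\<theta> x. \<theta> \<in> {\<theta>s, \<theta>AO} \<Longrightarrow> \<delta> \<theta> x = \<delta>' (predicted_outcome x \<theta>)"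
            "mono \<delta>'" "L > 0" "\<And>y y'. \<bar>\<delta>' y - \<delta>' y'\<bar> \<le> L * \<bar>y - y'\<bar>"
    and lam: "lam = \<gamma> * (\<theta>AO \<bullet> ((E ** transpose E) *v \<theta>AO) - \<theta>s \<bullet> ((E ** transpose E) *v \<theta>s))"
  shows "lam \<ge> 0 \<and>
    (\<forall>m > 0. measure M {\<omega> \<in> space M.
        admission_chance M B W \<theta>s \<omega> - admission_chance M B W \<theta>AO \<omega> > m}
      \<le> cdf std_normal_distribution ((- m / L - lam) / (\<sigma> * norm (\<theta>AO - \<theta>s))))"
proof (intro conjI allI impI)
  interpret single_dm_round M B Ef g N \<theta>s \<Theta> \<delta> W Y
    by (rule model)
  let ?G = "E ** transpose E"
  \<comment> \<open>The alignment condition cancels the \<open>\<gamma>\<close> terms, leaving a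
    positive multiple of the Gram image; the factor \<open>k\<close> then disappears under
    normalisation.\<close>
  have k: "\<alpha> + \<gamma> *\<^sub>R (?G *v \<theta>s) = k *\<^sub>R (?G *v \<theta>s)"
    by (simp add: c2(1) scaleR_left_diff_distrib)
  have nz: "?G *v \<theta>s \<noteq> 0"
    using AO_nonzero unfolding k by auto
  have AO_eq: "\<theta>AO = (?G *v \<theta>s) /\<^sub>R norm (?G *v \<theta>s)"
    using c2(2) unfolding AO k by simp
  have le: "\<theta>s \<bullet> (?G *v \<theta>s) \<le> \<theta>AO \<bullet> (?G *v \<theta>AO)"
    by (rule gram_form_le_normalized_image[OF nz c1 AO_eq])
  show "lam \<ge> 0"
    using le H2(2) by (simp add: lam)
  fix m :: real assume m: "m > 0"
  \<comment> \<open>Both parameters must be admissible for the Bernoulli selection law to apply to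
    them.\<close>
  have "norm \<theta>AO = 1"
    using nz by (simp add: AO_eq)
  then have in_\<Theta>: "\<theta>s \<in> \<Theta>" "\<theta>AO \<in> \<Theta>"
    using c1 by (auto simp: S2)
  define s where "s = \<sigma> * norm (\<theta>AO - \<theta>s)"
  have s: "s > 0"
    using c3(2) AO_neq by (simp add: s_def)
  have [measurable]: "B \<in> borel_measurable M"
    by (rule baseline_measurable)
  have normal: "distributed M lborel (\<lambda>\<omega>. B \<omega> \<bullet> (\<theta>AO - \<theta>s)) (normal_density 0 s)"
    using isotropic_normal_inner[of B \<sigma> "\<theta>AO - \<theta>s"] c3 AO_neq
    by (simp add: s_def mv_normal_density_isotropic)
  have chance: "AE \<omega> in M. admission_chance M B W \<theta> \<omega> = \<delta> \<theta> (B \<omega> + \<gamma> *\<^sub>R (?G *v \<theta>))"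
    if "\<theta> \<in> \<Theta>" for \<theta>
    by (rule admission_chance_eq) (auto simp: H1 H2(1) that)
  \<comment> \<open>Admission chances are known only almost surely, so the inclusion of events is
    almost sure too. The conclusion is weak, although a strict inequality holds, to match the closed
    half-line of the distribution function.\<close>
  have "AE \<omega> in M. admission_chance M B W \<theta>s \<omega> - admission_chance M B W \<theta>AO \<omega> > m \<longrightarrow>
      B \<omega> \<bullet> (\<theta>AO - \<theta>s) \<le> - m / L - lam"
    using chance[OF in_\<Theta>(1)] chance[OF in_\<Theta>(2)]
  proof eventually_elim
    case (elim \<omega>)
    define ys where "ys = (B \<omega> + \<gamma> *\<^sub>R (?G *v \<theta>s)) \<bullet> \<theta>s"
    define yA where "yA = (B \<omega> + \<gamma> *\<^sub>R (?G *v \<theta>AO)) \<bullet> \<theta>AO"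
    \<comment> \<open>\<open>ys\<close> and \<open>yA\<close> are the predicted outcomes of the same
      agent after its best response to each deployment. The baseline parts leave the Gaussian term,
      and the effort parts differ by exactly \<open>lam\<close>.\<close>
    have diff: "ys - yA = - (B \<omega> \<bullet> (\<theta>AO - \<theta>s)) - lam"
      by (simp add: ys_def yA_def lam inner_add_left inner_diff_right inner_commute algebra_simps)
    show ?case
    proof
      assume "m < admission_chance M B W \<theta>s \<omega> - admission_chance M B W \<theta>AO \<omega>"
      then have *: "m < \<delta>' ys - \<delta>' yA"
        using elim by (simp add: c4(1) predicted_outcome_def ys_def yA_def)
      \<comment> \<open>Monotonicity fixes the sign: with \<open>ys \<le> yA\<close> the gap could
        not exceed the positive \<open>m\<close>. The absolute value in the Lipschitz bound can then
        be dropped, which makes the bound one-sided.\<close>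
      have "ys > yA"
        using * m monoD[OF c4(2), of ys yA] by linarith
      then have "m < L * (ys - yA)"
        using * c4(4)[of ys yA] by simp
      then have "m / L < ys - yA"
        using c4(3) by (simp add: divide_less_eq mult.commute)
      then show "B \<omega> \<bullet> (\<theta>AO - \<theta>s) \<le> - m / L - lam"
        using diff by simp
    qed
  qed
  then have "prob {\<omega> \<in> space M.
        admission_chance M B W \<theta>s \<omega> - admission_chance M B W \<theta>AO \<omega> > m}
      \<le> prob {\<omega> \<in> space M. B \<omega> \<bullet> (\<theta>AO - \<theta>s) \<le> - m / L - lam}"
    by (intro finite_measure_mono_AE) auto
  also have "\<dots> = cdf std_normal_distribution ((- m / L - lam) / s)"
    by (rule normal_lower_tail[OF normal s])
  finally show "prob {\<omega> \<in> space M.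
        admission_chance M B W \<theta>s \<omega> - admission_chance M B W \<theta>AO \<omega> > m}
      \<le> cdf std_normal_distribution ((- m / L - lam) / (\<sigma> * norm (\<theta>AO - \<theta>s)))"
    by (simp only: s_def)
qed

end
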